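(* Let $T>0$ and let $X$ be an $\mathbb{N}$-valued random variable with density $f:\mathbb{N}\to(0,\infty)$ with respect to $\pi_T$ satisfying $\sum_{k\in\mathbb{N}}\frac{(Df(k))^2}{f(k)}\pi_T(k)<\infty$. Then the equality $$I(T_a(X)|\pi_{aT})=a\,I(X|\pi_T)$$ holds for every $a\in(0,1)$ if and only if there exist $\beta,\gamma\in\mathbb{R}$ such that $f(k)=e^{\beta k+\gamma}$ for all $k\in\mathbb{N}$ (that is, $X$ is Poisson distributed).
   Context: $\mathbb{N}=\{0,1,2,\dots\}$. For $T>0$, $\pi_T(k)=e^{-T}T^k/k!$ is the Poisson measure on $\mathbb{N}$. "$X$ has density $f$ with respect to $\pi_T$" means $\mathbb{P}(X=k)=f(k)\pi_T(k)$ for all $k$. $Dg(k)=g(k+1)-g(k)$. For $a\in[0,1]$ the $a$-thinning of $X$ is $T_a(X):=\sum_{i=1}^X B_i$, where $(B_i)_{i\ge1}$ are i.i.d. Bernoulli random variables with $\mathbb{P}(B_i=1)=a$, independent of $X$. If $Y$ has density $g$ with respect to $\pi_t$, $t>0$, the Fisher information is $I(Y|\pi_t)=t\sum_k\frac{(Dg(k))^2}{g(k)}\pi_t(k)$. *)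

theory Defs
  imports "HOL-Probability.Probability"
begin

definition has_poisson_density ::
  "'a measure \<Rightarrow> ('a \<Rightarrow> nat) \<Rightarrow> (nat \<Rightarrow> real) \<Rightarrow> real \<Rightarrow> bool" where
  "has_poisson_density M X f T \<longleftrightarrow>
     (\<forall>k. measure M {\<omega> \<in> space M. X \<omega> = k} = f k * pmf (poisson_pmf T) k)"

definition poisson_density :: "'a measure \<Rightarrow> ('a \<Rightarrow> nat) \<Rightarrow> real \<Rightarrow> nat \<Rightarrow> real" where
  "poisson_density M Y t k = measure M {\<omega> \<in> space M. Y \<omega> = k} / pmf (poisson_pmf t) k"

text \<open>For positive parameter the density always exists and is unique.\<close>

lemma has_poisson_density_iff:
  assumes "t > 0"
  shows "has_poisson_density M Y g t \<longleftrightarrow> g = poisson_density M Y t"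
proof -
  have "pmf (poisson_pmf t) k \<noteq> 0" for k
    using assms by simp
  then show ?thesis
    by (auto simp: has_poisson_density_def poisson_density_def fun_eq_iff field_simps)
qed

definition forward_diff :: "(nat \<Rightarrow> real) \<Rightarrow> nat \<Rightarrow> real" where
  "forward_diff g k = g (k + 1) - g k"

text \<open>
  The Fisher information takes values in the extended nonnegative reals, so that a divergent
  series has the value infinity. The quotient is taken there too: where the density vanishes, the
  summand is infinite if the difference is nonzero and 0 otherwise.
\<close>

definition fisher_information :: "'a measure \<Rightarrow> ('a \<Rightarrow> nat) \<Rightarrow> real \<Rightarrow> ennreal" where
  "fisher_information M Y t =
     (let g = poisson_density M Y t in
      ennreal t * (\<Sum>k. ennreal ((forward_diff g k)\<^sup>2) / ennreal (g k) * ennreal (pmf (poisson_pmf t) k)))"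

text \<open>
  \<open>Y\<close> is an \<open>a\<close>-thinning of \<open>X\<close>: \<open>Y = B 1 + \<dots> + B X\<close> with \<open>B 1, B 2, \<dots>\<close> i.i.d. Bernoulli
  variables (with values 0 and 1) independent of \<open>X\<close>. The independence is that of the family
  \<open>X, B 1, B 2, \<dots>\<close>, where \<open>X\<close> takes the place of the unused index 0; it includes measurability.
\<close>

definition is_thinning ::
  "'a measure \<Rightarrow> real \<Rightarrow> ('a \<Rightarrow> nat) \<Rightarrow> ('a \<Rightarrow> nat) \<Rightarrow> bool" where
  "is_thinning M a X Y \<longleftrightarrow>
     (\<exists>B :: nat \<Rightarrow> 'a \<Rightarrow> nat.
        prob_space.indep_vars M (\<lambda>_. count_space UNIV) (B(0 := X)) UNIV \<and>
        (\<forall>i\<ge>1. distr M (count_space UNIV) (B i) =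
           measure_pmf (map_pmf of_bool (bernoulli_pmf a))) \<and>
        (\<forall>\<omega>\<in>space M. Y \<omega> = (\<Sum>i=1..X \<omega>. B i \<omega>)))"

end

theory Submission
  imports Defs
begin

text \<open>
  The \<open>a\<close>-thinning has density \<open>g(j) = \<Sum>m. f(j + m) \<pi>\<^sub>s(m)\<close> with \<open>s = (1 - a) T\<close>, so \<open>Dg\<close> is obtained
  from \<open>Df\<close> by the same Poisson average. By the Cauchy--Schwarz inequality \<open>(Dg)\<^sup>2 / g\<close> is at most the
  average of \<open>(Df)\<^sup>2 / f\<close>, and averaging over \<open>\<pi>\<^bsub>aT\<^esub>\<close> turns the latter into the sum over \<open>\<pi>\<^sub>T\<close>, because
  \<open>\<pi>\<^bsub>aT\<^esub>\<close> and \<open>\<pi>\<^sub>s\<close> convolve to \<open>\<pi>\<^sub>T\<close>. The gap between the two sides is thus an explicit sum of weighted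
  squares of \<open>Df - c\<^sub>j f\<close>; it vanishes (already for a single \<open>a\<close>) iff \<open>Df / f\<close> is constant, i.e. iff
  \<open>f\<close> is geometric.
\<close>

section \<open>Convolution of Poisson weights\<close>

lemma suminf_ennreal_swap:
  fixes G :: "nat \<Rightarrow> nat \<Rightarrow> ennreal"
  shows "(\<Sum>j. \<Sum>k. G j k) = (\<Sum>k. \<Sum>j. G j k)"
proof -
  have "(\<Sum>j. \<Sum>k. G j k) = (\<integral>\<^sup>+j. (\<Sum>k. G j k) \<partial>count_space UNIV)"
    by (simp add: nn_integral_count_space_nat)
  also have "\<dots> = (\<Sum>k. \<integral>\<^sup>+j. G j k \<partial>count_space UNIV)"
    by (rule nn_integral_suminf) simp
  finally show ?thesis
    by (simp add: nn_integral_count_space_nat)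
qed

text \<open>Once \<open>exp (- (u + s)) / fact k\<close> is factored out, this is the binomial
  theorem.\<close>

lemma pmf_poisson_convolution:
  assumes "u > 0" "s > 0"
  shows "(\<Sum>j\<le>k. pmf (poisson_pmf u) j * pmf (poisson_pmf s) (k - j)) = pmf (poisson_pmf (u + s)) k"
proof -
  have "(\<Sum>j\<le>k. pmf (poisson_pmf u) j * pmf (poisson_pmf s) (k - j))
      = (\<Sum>j\<le>k. exp (- (u + s)) / fact k * (of_nat (k choose j) * u ^ j * s ^ (k - j)))"
    using assms
    by (intro sum.cong refl) (simp add: binomial_fact exp_add[symmetric] exp_minus field_simps flip: exp_add)
  also have "\<dots> = exp (- (u + s)) / fact k * (u + s) ^ k"
    by (simp add: binomial_ring sum_distrib_left mult.assoc)
  finally show ?thesis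
    using assms by simp
qed

text \<open>Regroup the pairs \<open>(j, m)\<close> along the diagonals \<open>j + m = k\<close> and
  convolve the weights on each. With values in \<open>ennreal\<close> the rearrangement is Tonelli
  and needs no summability. It collapses the twofold average of \<open>(Df)^2 / f\<close> to a
  single Poisson sum.\<close>

lemma suminf_poisson_convolution:
  fixes F :: "nat \<Rightarrow> ennreal"
  assumes "u > 0" "s > 0"
  shows "(\<Sum>j. (\<Sum>m. F (j + m) * ennreal (pmf (poisson_pmf s) m)) * ennreal (pmf (poisson_pmf u) j))
       = (\<Sum>k. F k * ennreal (pmf (poisson_pmf (u + s)) k))"
proof -
  \<comment> \<open>Substituting \<open>k = j + m\<close> makes the inner range start at
    \<open>j\<close>; extending by zero below the diagonal gives a double sum over all pairs, whose
    order can be exchanged.\<close>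
  define G where "G j k = (if j \<le> k then F k * ennreal (pmf (poisson_pmf s) (k - j)) * ennreal (pmf (poisson_pmf u) j) else 0)"
    for j k
  have "(\<Sum>m. F (j + m) * ennreal (pmf (poisson_pmf s) m)) * ennreal (pmf (poisson_pmf u) j) = (\<Sum>k. G j k)" for j
  proof -
    have "(\<Sum>k. G j k) = (\<Sum>m. G j (m + j)) + (\<Sum>k<j. G j k)"
      by (rule suminf_offset) simp
    also have "(\<Sum>k<j. G j k) = 0"
      by (simp add: G_def)
    finally show ?thesis
      by (simp add: G_def add.commute ennreal_suminf_multc del: pmf_poisson)
  qed
  then have "(\<Sum>j. (\<Sum>m. F (j + m) * ennreal (pmf (poisson_pmf s) m)) * ennreal (pmf (poisson_pmf u) j))
     = (\<Sum>k. \<Sum>j. G j k)"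
    by (simp only: suminf_ennreal_swap[of G])
  moreover have "(\<Sum>j. G j k) = F k * ennreal (pmf (poisson_pmf (u + s)) k)" for k
  proof -
    have "(\<Sum>j. G j k) = (\<Sum>j\<le>k. G j k)"
      by (rule suminf_finite) (auto simp: G_def)
    also have "\<dots> = (\<Sum>j\<le>k. F k * ennreal (pmf (poisson_pmf u) j * pmf (poisson_pmf s) (k - j)))"
      by (intro sum.cong refl) (simp add: G_def ennreal_mult mult_ac del: pmf_poisson)
    also have "\<dots> = F k * ennreal (pmf (poisson_pmf (u + s)) k)"
      using assms by (simp add: sum_distrib_left[symmetric] sum_ennreal pmf_poisson_convolution del: pmf_poisson)
    finally show ?thesis .
  qed
  ultimately show ?thesis
    by (simp only:)
qed

section \<open>Cauchy-Schwarz with explicit remainder\<close>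

text \<open>Expand the square. For \<open>G > 0\<close> the coefficient \<open>H / G\<close> is the
  \<open>c\<close> that minimises \<open>Q - 2 c H + c^2 G\<close>. For nonnegative \<open>w\<close>
  the left-hand terms are nonnegative, which gives \<open>H^2 / G \<le> Q\<close> together with its
  equality case.\<close>

lemma cauchy_schwarz_defect:
  fixes f h w :: "nat \<Rightarrow> real"
  assumes f: "\<And>m. f m > 0" and "G \<noteq> 0"
    and G: "(\<lambda>m. f m * w m) sums G"
    and H: "(\<lambda>m. h m * w m) sums H"
    and Q: "(\<lambda>m. (h m)\<^sup>2 / f m * w m) sums Q"
  shows "(\<lambda>m. (h m - H / G * f m)\<^sup>2 / f m * w m) sums (Q - H\<^sup>2 / G)"
proof -
  have "(\<lambda>m. (h m)\<^sup>2 / f m * w m - 2 * (H / G) * (h m * w m) + (H / G)\<^sup>2 * (f m * w m))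
      sums (Q - 2 * (H / G) * H + (H / G)\<^sup>2 * G)"
    by (intro sums_add sums_diff sums_mult G H Q)
  moreover have "(h m)\<^sup>2 / f m * w m - 2 * (H / G) * (h m * w m) + (H / G)\<^sup>2 * (f m * w m)
      = (h m - H / G * f m)\<^sup>2 / f m * w m" for m
    using f[of m] \<open>G \<noteq> 0\<close> by (simp add: field_simps power2_eq_square)
  moreover have "Q - 2 * (H / G) * H + (H / G)\<^sup>2 * G = Q - H\<^sup>2 / G"
    using \<open>G \<noteq> 0\<close> by (simp add: field_simps power2_eq_square)
  ultimately show ?thesis
    by (simp only:)
qed

section \<open>Law of the thinned variable\<close>

text \<open>Pascal's rule, in the form of adding one Bernoulli trial. The case \<open>j = 0\<close>
  is split off because truncated \<open>j - 1\<close> would produce a spurious term there.\<close>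

lemma binomial_weight_Suc:
  fixes a b :: "'a :: comm_semiring_1"
  shows "of_nat (Suc n choose j) * a ^ j * b ^ (Suc n - j)
    = of_nat (n choose j) * a ^ j * b ^ (n - j) * b
    + (if j = 0 then 0 else of_nat (n choose (j - 1)) * a ^ (j - 1) * b ^ (n - (j - 1)) * a)"
proof (cases j)
  case 0
  then show ?thesis by (simp add: mult.commute)
next
  case (Suc i)
  show ?thesis
  \<comment> \<open>For \<open>i < n\<close> a factor \<open>b\<close> splits off the power;
    otherwise \<open>n choose Suc i\<close> vanishes and the truncated exponent
    \<open>n - Suc i\<close> is harmless.\<close>
  proof (cases "i < n")
    case True
    then have "n - i = Suc (n - Suc i)"
      by simp
    then show ?thesis
      by (simp add: Suc algebra_simps)
  next
    case False
    then show ?thesis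
      by (simp add: Suc binomial_eq_0 algebra_simps)
  qed
qed

text \<open>Induction on the number \<open>n\<close> of trials, kept separate from the value
  \<open>k\<close> of \<open>X\<close> so that the step only adds one independent trial. The
  instance \<open>n = k\<close> describes the thinning on the event \<open>X = k\<close>.\<close>

lemma (in prob_space) prob_thinning_partial_sum:
  fixes X :: "'a \<Rightarrow> nat" and B :: "nat \<Rightarrow> 'a \<Rightarrow> nat"
  assumes a: "0 \<le> a" "a \<le> 1"
    and indep: "indep_vars (\<lambda>_. count_space UNIV) (B(0 := X)) UNIV"
    and distr: "\<And>i. i \<ge> 1 \<Longrightarrow> distr M (count_space UNIV) (B i) = measure_pmf (map_pmf of_bool (bernoulli_pmf a))"
  shows "prob {\<omega> \<in> space M. X \<omega> = k \<and> (\<Sum>i=1..n. B i \<omega>) = j}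
       = prob {\<omega> \<in> space M. X \<omega> = k} * (real (n choose j) * a ^ j * (1 - a) ^ (n - j))"
proof (induction n arbitrary: j)
  case 0
  show ?case by (cases j) auto
next
  case (Suc n)
  let ?N = "\<lambda>_::nat. count_space (UNIV :: nat set)"
  have [measurable]: "(B(0 := X)) i \<in> measurable M (count_space UNIV)" for i
    using indep by (auto simp: indep_vars_def)
  have [measurable]: "X \<in> measurable M (count_space UNIV)"
    using \<open>(B(0 := X)) 0 \<in> _\<close> by simp
  have B[measurable]: "B (Suc i) \<in> measurable M (count_space UNIV)" for i
    using \<open>(B(0 := X)) (Suc i) \<in> _\<close> by simp
  have S[measurable]: "(\<lambda>\<omega>. \<Sum>i=1..n. B i \<omega>) \<in> measurable M (count_space UNIV)"
  proof (rule measurable_sum_nat)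
    fix i assume "i \<in> {1..n}"
    then show "B i \<in> measurable M (count_space UNIV)" using B[of "i - 1"] by simp
  qed
  have step: "prob {\<omega> \<in> space M. X \<omega> = k \<and> (\<Sum>i=1..n. B i \<omega>) = l \<and> B (Suc n) \<omega> = b}
      = prob {\<omega> \<in> space M. X \<omega> = k \<and> (\<Sum>i=1..n. B i \<omega>) = l} * pmf (map_pmf of_bool (bernoulli_pmf a)) b"
    for l b
  proof -
    \<comment> \<open>Functions of disjoint blocks of an independent family are independent: the
      block \<open>{0..n}\<close> carries \<open>X\<close> (at index 0) and the earlier trials, the
      block \<open>{Suc n}\<close> the new one.\<close>
    let ?K = "case_bool {0..n} {Suc n}"
    have "indep_vars (\<lambda>c. PiM (?K c) ?N) (\<lambda>c \<omega>. restrict (\<lambda>i. (B(0 := X)) i \<omega>) (?K c)) UNIV"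
      by (rule indep_vars_restrict[OF indep]) (auto simp: disjoint_family_on_def split: bool.splits)
    then have iv: "indep_var (PiM {0..n} ?N) (\<lambda>\<omega>. restrict (\<lambda>i. (B(0 := X)) i \<omega>) {0..n})
        (PiM {Suc n} ?N) (\<lambda>\<omega>. restrict (\<lambda>i. (B(0 := X)) i \<omega>) {Suc n})"
      unfolding indep_var_def
      by (rule iffD1[OF indep_vars_cong, rotated -1]) (auto split: bool.splits)
    have A: "{w \<in> space (PiM {0..n} ?N). w 0 = k \<and> (\<Sum>i=1..n. w i) = l} \<in> sets (PiM {0..n} ?N)"
      by measurable
    have C: "{w \<in> space (PiM {Suc n} ?N). w (Suc n) = b} \<in> sets (PiM {Suc n} ?N)"
      by measurable
    have "prob (B (Suc n) -` {b} \<inter> space M) = measure (distr M (count_space UNIV) (B (Suc n))) {b}"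
      by (simp add: measure_distr)
    also have "\<dots> = pmf (map_pmf of_bool (bernoulli_pmf a)) b"
      by (simp add: distr pmf.rep_eq)
    finally have D: "prob {\<omega> \<in> space M. B (Suc n) \<omega> = b} = pmf (map_pmf of_bool (bernoulli_pmf a)) b"
      by (simp add: vimage_def Int_def conj_commute)
    show ?thesis
      using indep_varD[OF iv A C] unfolding D[symmetric]
      by (simp add: vimage_def Int_def space_PiM PiE_def extensional_def restrict_def conj_ac cong: conj_cong)
  qed
  have one: "pmf (map_pmf of_bool (bernoulli_pmf a)) (Suc 0) = a"
    and zero: "pmf (map_pmf of_bool (bernoulli_pmf a)) (0::nat) = 1 - a"
    using a pmf_map_inj'[of "of_bool :: bool \<Rightarrow> nat" "bernoulli_pmf a" True]
      pmf_map_inj'[of "of_bool :: bool \<Rightarrow> nat" "bernoulli_pmf a" False]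
    by (simp_all add: inj_def)
  have split: "prob {\<omega> \<in> space M. X \<omega> = k \<and> (\<Sum>i=1..Suc n. B i \<omega>) = j}
      = prob {\<omega> \<in> space M. X \<omega> = k \<and> (\<Sum>i=1..n. B i \<omega>) = j} * (1 - a)
      + (if j = 0 then 0 else prob {\<omega> \<in> space M. X \<omega> = k \<and> (\<Sum>i=1..n. B i \<omega>) = j - 1} * a)"
  proof -
    \<comment> \<open>Only the law of \<open>B (Suc n)\<close> is prescribed, so it is 0 or 1 merely
      almost surely, and the event is split up to a null set.\<close>
    have "AE \<omega> in M. B (Suc n) \<omega> \<in> {0, 1}"
    proof -
      have "AE b in distr M (count_space UNIV) (B (Suc n)). b \<in> {0, 1}"
        unfolding distr[of "Suc n", simplified] by (auto simp: AE_measure_pmf_iff)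
      then show ?thesis
        by (subst (asm) AE_distr_iff) auto
    qed
    then have AE: "AE \<omega> in M. X \<omega> = k \<and> (\<Sum>i=1..Suc n. B i \<omega>) = j \<longleftrightarrow>
        X \<omega> = k \<and> (\<Sum>i=1..n. B i \<omega>) = j \<and> B (Suc n) \<omega> = 0 \<or>
        X \<omega> = k \<and> Suc (\<Sum>i=1..n. B i \<omega>) = j \<and> B (Suc n) \<omega> = 1"
      by (rule eventually_mono) auto
    define A\<^sub>0 where "A\<^sub>0 = {\<omega> \<in> space M. X \<omega> = k \<and> (\<Sum>i=1..n. B i \<omega>) = j \<and> B (Suc n) \<omega> = 0}"
    define A\<^sub>1 where "A\<^sub>1 = {\<omega> \<in> space M. X \<omega> = k \<and> Suc (\<Sum>i=1..n. B i \<omega>) = j \<and> B (Suc n) \<omega> = 1}"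
    have sets: "A\<^sub>0 \<in> events" "A\<^sub>1 \<in> events"
      "{\<omega> \<in> space M. X \<omega> = k \<and> (\<Sum>i=1..n. B i \<omega>) + B (Suc n) \<omega> = j} \<in> events"
      unfolding A\<^sub>0_def A\<^sub>1_def by measurable
    have "prob {\<omega> \<in> space M. X \<omega> = k \<and> (\<Sum>i=1..Suc n. B i \<omega>) = j} = prob (A\<^sub>0 \<union> A\<^sub>1)"
    proof (rule finite_measure_eq_AE)
      show "AE \<omega> in M. \<omega> \<in> {\<omega> \<in> space M. X \<omega> = k \<and> (\<Sum>i=1..Suc n. B i \<omega>) = j} \<longleftrightarrow> \<omega> \<in> A\<^sub>0 \<union> A\<^sub>1"
        using AE AE_space by eventually_elim (auto simp: A\<^sub>0_def A\<^sub>1_def)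
      show "{\<omega> \<in> space M. X \<omega> = k \<and> (\<Sum>i=1..Suc n. B i \<omega>) = j} \<in> events"
        using sets(3) by simp
    qed (use sets in auto)
    also have "\<dots> = prob A\<^sub>0 + prob A\<^sub>1"
      using sets by (intro finite_measure_Union) (auto simp: A\<^sub>0_def A\<^sub>1_def)
    also have "prob A\<^sub>1 = (if j = 0 then 0 else prob {\<omega> \<in> space M. X \<omega> = k \<and> (\<Sum>i=1..n. B i \<omega>) = j - 1} * a)"
      using step[of "j - 1" 1] one by (cases j) (simp_all add: A\<^sub>1_def)
    also have "prob A\<^sub>0 = prob {\<omega> \<in> space M. X \<omega> = k \<and> (\<Sum>i=1..n. B i \<omega>) = j} * (1 - a)"
      unfolding A\<^sub>0_def step zero ..
    finally show ?thesis .
  qed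
  show ?case
    unfolding split Suc.IH binomial_weight_Suc by (simp add: distrib_left mult.assoc)
qed

text \<open>Given \<open>X = j + m\<close> the thinning is binomial, and \<pi>_T(j + m) times its
  binomial weight at \<open>j\<close> factors as \<pi>_{aT}(j) \<pi>_{(1 - a)T}(m). Dividing by
  \<pi>_{aT}(j) leaves the stated average.\<close>

lemma (in prob_space) poisson_density_thinning:
  fixes X Y :: "'a \<Rightarrow> nat"
  assumes a: "0 < a" "a < 1" and "T > 0"
    and f: "has_poisson_density M X f T"
    and thin: "is_thinning M a X Y"
  shows "(\<lambda>m. f (j + m) * pmf (poisson_pmf ((1 - a) * T)) m) sums poisson_density M Y (a * T) j"
proof -
  let ?b = "\<lambda>k. real (k choose j) * a ^ j * (1 - a) ^ (k - j)"
  obtain B where indep: "indep_vars (\<lambda>_. count_space UNIV) (B(0 := X)) UNIV"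
    and distr: "\<And>i. i \<ge> 1 \<Longrightarrow> distr M (count_space UNIV) (B i) = measure_pmf (map_pmf of_bool (bernoulli_pmf a))"
    and Y: "\<And>\<omega>. \<omega> \<in> space M \<Longrightarrow> Y \<omega> = (\<Sum>i=1..X \<omega>. B i \<omega>)"
    using thin unfolding is_thinning_def by blast
  have rv: "(B(0 := X)) i \<in> measurable M (count_space UNIV)" for i
    using indep by (auto simp: indep_vars_def)
  have [measurable]: "X \<in> measurable M (count_space UNIV)"
    using rv[of 0] by simp
  have [measurable]: "(\<lambda>\<omega>. \<Sum>i=1..k. B i \<omega>) \<in> measurable M (count_space UNIV)" for k
  proof (rule measurable_sum_nat)
    fix i assume "i \<in> {1..k}"
    then show "B i \<in> measurable M (count_space UNIV)" using rv[of i] by simp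
  qed
  have "(\<lambda>k. prob {\<omega> \<in> space M. X \<omega> = k \<and> (\<Sum>i=1..k. B i \<omega>) = j})
      sums prob (\<Union>k. {\<omega> \<in> space M. X \<omega> = k \<and> (\<Sum>i=1..k. B i \<omega>) = j})"
    by (intro finite_measure_UNION image_subsetI; (measurable)?) (auto simp: disjoint_family_on_def)
  moreover have "(\<Union>k. {\<omega> \<in> space M. X \<omega> = k \<and> (\<Sum>i=1..k. B i \<omega>) = j}) = {\<omega> \<in> space M. Y \<omega> = j}"
    using Y by auto
  moreover have "prob {\<omega> \<in> space M. X \<omega> = k \<and> (\<Sum>i=1..k. B i \<omega>) = j} = f k * pmf (poisson_pmf T) k * ?b k" for k
    using prob_thinning_partial_sum[OF _ _ indep distr, of k k j] a f
    by (simp add: has_poisson_density_def)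
  ultimately have "(\<lambda>k. f k * pmf (poisson_pmf T) k * ?b k) sums prob {\<omega> \<in> space M. Y \<omega> = j}"
    by (simp only:)
  \<comment> \<open>Here \<open>k choose j = 0\<close>, so the series may be started at
    \<open>k = j\<close>.\<close>
  moreover have low: "(\<Sum>k<j. f k * pmf (poisson_pmf T) k * ?b k) = 0"
    by (intro sum.neutral) auto
  ultimately have "(\<lambda>m. f (m + j) * pmf (poisson_pmf T) (m + j) * ?b (m + j)) sums prob {\<omega> \<in> space M. Y \<omega> = j}"
    using sums_iff_shift[of "\<lambda>k. f k * pmf (poisson_pmf T) k * ?b k" j "prob {\<omega> \<in> space M. Y \<omega> = j}"]
    by (simp only: low add_0_right)
  then have "(\<lambda>m. f (m + j) * pmf (poisson_pmf T) (m + j) * ?b (m + j) / pmf (poisson_pmf (a * T)) j)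
      sums poisson_density M Y (a * T) j"
    unfolding poisson_density_def by (rule sums_divide)
  moreover have "f (m + j) * pmf (poisson_pmf T) (m + j) * ?b (m + j) / pmf (poisson_pmf (a * T)) j
      = f (j + m) * pmf (poisson_pmf ((1 - a) * T)) m" for m
  proof -
    have "exp (- T) = exp (- (a * T)) * exp (- ((1 - a) * T))"
      by (simp add: algebra_simps flip: exp_add)
    then show ?thesis
      using a \<open>T > 0\<close>
      by (simp add: binomial_fact add.commute power_add power_mult_distrib)
  qed
  ultimately show ?thesis
    by (simp only:)
qed

section \<open>Fisher information under thinning\<close>

lemma fisher_information_positive_density:
  assumes "\<And>k. poisson_density M Y t k > 0"
  shows "fisher_information M Y t = ennreal t *
    (\<Sum>k. ennreal ((forward_diff (poisson_density M Y t) k)\<^sup>2 / poisson_density M Y t k) * ennreal (pmf (poisson_pmf t) k))"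
  using assms by (simp add: fisher_information_def Let_def divide_ennreal del: pmf_poisson)

text \<open>For each \<open>j\<close>, \<open>cauchy_schwarz_defect\<close> is applied to
  \<open>f (j + m)\<close> and its difference with weights \<pi>_s(m), where \<open>H / G\<close>
  becomes \<open>Dg(j) / g(j)\<close>; averaging over \<pi>_{aT} and convolving gives the identity.
  The gap is an added term because subtraction in \<open>ennreal\<close> truncates.\<close>

lemma (in prob_space)
  fixes X Y :: "'a \<Rightarrow> nat" and a T :: real and f :: "nat \<Rightarrow> real"
  defines "s \<equiv> (1 - a) * T"
  defines "g \<equiv> poisson_density M Y (a * T)"
  assumes a: "0 < a" "a < 1" and T: "T > 0"
    and pos: "\<And>k. f k > 0"
    and f: "has_poisson_density M X f T"
    and thin: "is_thinning M a X Y"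
  shows poisson_density_thinning_pos: "g j > 0"
    and forward_diff_poisson_density_thinning:
      "(\<lambda>m. forward_diff f (j + m) * pmf (poisson_pmf s) m) sums forward_diff g j"
    and fisher_information_thinning_defect:
      "summable (\<lambda>k. (forward_diff f k)\<^sup>2 / f k * pmf (poisson_pmf T) k) \<Longrightarrow>
       ennreal a * fisher_information M X T = fisher_information M Y (a * T) + ennreal (a * T) *
         (\<Sum>j. (\<Sum>m. ennreal ((forward_diff f (j + m) - forward_diff g j / g j * f (j + m))\<^sup>2 / f (j + m)
             * pmf (poisson_pmf s) m)) * ennreal (pmf (poisson_pmf (a * T)) j))"
proof -
  have aT: "a * T > 0" and s: "s > 0" and T_split: "a * T + s = T"
    using a T by (simp_all add: s_def algebra_simps)
  have pi_pos: "pmf (poisson_pmf s) m > 0" "pmf (poisson_pmf (a * T)) m > 0" for m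
    using s aT by simp_all
  have g: "(\<lambda>m. f (j + m) * pmf (poisson_pmf s) m) sums g j" for j
    unfolding s_def g_def by (rule poisson_density_thinning[OF a T f thin])
  show g_pos: "g j > 0" for j
    using suminf_pos[OF sums_summable[OF g[of j]]] sums_unique[OF g[of j]] pos pi_pos by simp
  \<comment> \<open>The averages at \<open>j + 1\<close> and \<open>j\<close> have the same weights,
    so they can be subtracted termwise: thinning commutes with the forward difference.\<close>
  show Dg: "(\<lambda>m. forward_diff f (j + m) * pmf (poisson_pmf s) m) sums forward_diff g j" for j
    using sums_diff[OF g[of "j + 1"] g[of j]] by (simp add: forward_diff_def algebra_simps)
  let ?F = "\<lambda>k. (forward_diff f k)\<^sup>2 / f k"
  let ?R = "\<lambda>j m. (forward_diff f (j + m) - forward_diff g j / g j * f (j + m))\<^sup>2 / f (j + m) * pmf (poisson_pmf s) m"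
  assume summable: "summable (\<lambda>k. ?F k * pmf (poisson_pmf T) k)"
  have F_nonneg: "?F k \<ge> 0" for k
    using pos[of k] by simp
  have F_mult: "ennreal (?F k * x) = ennreal (?F k) * ennreal x" for k x
    using F_nonneg by (rule ennreal_mult')
  have conv: "(\<Sum>j. (\<Sum>m. ennreal (?F (j + m)) * ennreal (pmf (poisson_pmf s) m)) * ennreal (pmf (poisson_pmf (a * T)) j))
      = (\<Sum>k. ennreal (?F k) * ennreal (pmf (poisson_pmf T) k))"
    using suminf_poisson_convolution[OF aT s, of "\<lambda>k. ennreal (?F k)"] by (simp only: T_split)
  have "(\<Sum>k. ennreal (?F k) * ennreal (pmf (poisson_pmf T) k)) \<noteq> \<top>"
    unfolding F_mult[symmetric]
    by (intro ennreal_suminf_neq_top summable mult_nonneg_nonneg F_nonneg pmf_nonneg)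
  \<comment> \<open>A finite total bounds every row; since the weight of row \<open>j\<close> is
    positive, the row itself is then finite, as the real-valued identity requires.\<close>
  then have finite: "(\<Sum>m. ennreal (?F (j + m)) * ennreal (pmf (poisson_pmf s) m)) * ennreal (pmf (poisson_pmf (a * T)) j) < \<top>" for j
    using ennreal_suminf_lessD[of "\<lambda>j. (\<Sum>m. ennreal (?F (j + m)) * ennreal (pmf (poisson_pmf s) m)) * ennreal (pmf (poisson_pmf (a * T)) j)" \<top> j]
    unfolding conv by (simp only: less_top)
  have row: "(\<Sum>m. ennreal (?F (j + m)) * ennreal (pmf (poisson_pmf s) m))
      = ennreal ((forward_diff g j)\<^sup>2 / g j) + (\<Sum>m. ennreal (?R j m))" for j
  proof -
    have "(\<Sum>m. ennreal (?F (j + m)) * ennreal (pmf (poisson_pmf s) m)) \<noteq> \<top>"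
      using finite[of j] pi_pos(2)[of j] by (auto simp: ennreal_top_mult simp del: pmf_poisson)
    then have "(\<Sum>m. ennreal (?F (j + m) * pmf (poisson_pmf s) m)) \<noteq> \<top>"
      by (simp only: F_mult not_False_eq_True)
    then have sm: "summable (\<lambda>m. ?F (j + m) * pmf (poisson_pmf s) m)"
      by (intro summable_suminf_not_top mult_nonneg_nonneg F_nonneg pmf_nonneg)
    let ?Q = "\<Sum>m. ?F (j + m) * pmf (poisson_pmf s) m"
    have R: "?R j sums (?Q - (forward_diff g j)\<^sup>2 / g j)"
      using g_pos[of j]
      by (intro cauchy_schwarz_defect pos g Dg summable_sums sm) simp
    have R_nonneg: "?R j m \<ge> 0" for m
      using pos[of "j + m"] by (simp del: pmf_poisson)
    have "(\<Sum>m. ennreal (?F (j + m)) * ennreal (pmf (poisson_pmf s) m)) = ennreal ?Q"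
      unfolding F_mult[symmetric]
      by (intro suminf_ennreal2 sm mult_nonneg_nonneg F_nonneg pmf_nonneg)
    also have "\<dots> = ennreal ((forward_diff g j)\<^sup>2 / g j + suminf (?R j))"
      unfolding sums_unique[OF R, symmetric] by (simp only: add_diff_eq add_diff_cancel_left')
    also have "\<dots> = ennreal ((forward_diff g j)\<^sup>2 / g j) + ennreal (suminf (?R j))"
      by (intro ennreal_plus divide_nonneg_pos zero_le_power2 g_pos suminf_nonneg[OF sums_summable[OF R] R_nonneg])
    also have "ennreal (suminf (?R j)) = (\<Sum>m. ennreal (?R j m))"
      by (rule suminf_ennreal2[OF R_nonneg sums_summable[OF R], symmetric])
    finally show ?thesis .
  qed
  have "ennreal a * fisher_information M X T
      = ennreal (a * T) * (\<Sum>k. ennreal (?F k) * ennreal (pmf (poisson_pmf T) k))"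
    using fisher_information_positive_density[of M X T] f[unfolded has_poisson_density_iff[OF T], symmetric] pos a T
    by (simp add: ennreal_mult mult.assoc del: pmf_poisson)
  also have "\<dots> = ennreal (a * T) * ((\<Sum>j. ennreal ((forward_diff g j)\<^sup>2 / g j) * ennreal (pmf (poisson_pmf (a * T)) j))
      + (\<Sum>j. (\<Sum>m. ennreal (?R j m)) * ennreal (pmf (poisson_pmf (a * T)) j)))"
    unfolding conv[symmetric] row by (simp add: distrib_right suminf_add[symmetric] del: pmf_poisson)
  also have "\<dots> = fisher_information M Y (a * T)
      + ennreal (a * T) * (\<Sum>j. (\<Sum>m. ennreal (?R j m)) * ennreal (pmf (poisson_pmf (a * T)) j))"
    using fisher_information_positive_density[of M Y "a * T"] g_pos
    by (simp add: g_def distrib_left del: pmf_poisson)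
  finally show "ennreal a * fisher_information M X T = fisher_information M Y (a * T)
      + ennreal (a * T) * (\<Sum>j. (\<Sum>m. ennreal (?R j m)) * ennreal (pmf (poisson_pmf (a * T)) j))" .
qed

section \<open>Exponential densities and Poisson laws\<close>

text \<open>Proportionality is the recursion \<open>f (Suc k) = (1 + c) * f k\<close>, and
  positivity of \<open>f\<close> forces \<open>1 + c > 0\<close>, so that \<beta> is the logarithm
  of \<open>1 + c\<close> and \<gamma> that of \<open>f 0\<close>.\<close>

lemma forward_diff_proportional_iff_exp:
  assumes "\<And>k. f k > 0"
  shows "(\<exists>c. \<forall>k. forward_diff f k = c * f k) \<longleftrightarrow> (\<exists>\<beta> \<gamma>. \<forall>k. f k = exp (\<beta> * real k + \<gamma>))"
proof
  assume "\<exists>c. \<forall>k. forward_diff f k = c * f k"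
  then obtain c where "\<And>k. forward_diff f k = c * f k"
    by blast
  then have step: "f (Suc k) = (1 + c) * f k" for k
    by (simp add: forward_diff_def algebra_simps)
  have "1 + c > 0"
    using step[of 0] assms[of 0] assms[of "Suc 0"] by (simp add: zero_less_mult_iff)
  have "f k = exp (ln (1 + c) * real k + ln (f 0))" for k
  proof (induction k)
    case 0
    then show ?case using assms by simp
  next
    case (Suc k)
    then show ?case using \<open>1 + c > 0\<close> by (simp add: step exp_add algebra_simps)
  qed
  then show "\<exists>\<beta> \<gamma>. \<forall>k. f k = exp (\<beta> * real k + \<gamma>)"
    by blast
next
  assume "\<exists>\<beta> \<gamma>. \<forall>k. f k = exp (\<beta> * real k + \<gamma>)"
  then obtain \<beta> \<gamma> where "\<And>k. f k = exp (\<beta> * real k + \<gamma>)"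
    by blast
  then have "forward_diff f k = (exp \<beta> - 1) * f k" for k
    by (simp add: forward_diff_def algebra_simps exp_add)
  then show "\<exists>c. \<forall>k. forward_diff f k = c * f k"
    by blast
qed

lemma (in prob_space) exp_poisson_density_iff_poisson:
  fixes X :: "'a \<Rightarrow> nat"
  assumes T: "T > 0"
    and X[measurable]: "X \<in> measurable M (count_space UNIV)"
    and f: "has_poisson_density M X f T"
  shows "(\<exists>\<beta> \<gamma>. \<forall>k. f k = exp (\<beta> * real k + \<gamma>))
     \<longleftrightarrow> (\<exists>r>0. distr M (count_space UNIV) X = measure_pmf (poisson_pmf r))"
proof
  assume "\<exists>\<beta> \<gamma>. \<forall>k. f k = exp (\<beta> * real k + \<gamma>)"
  then obtain \<beta> \<gamma> where exp: "\<And>k. f k = exp (\<beta> * real k + \<gamma>)"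
    by blast
  \<comment> \<open>Exponential tilting of \<pi>_T by \<beta> multiplies its parameter by
    \<open>exp \<beta>\<close>.\<close>
  define r where "r = T * exp \<beta>"
  have "r > 0"
    using T by (simp add: r_def)
  have law: "prob {\<omega> \<in> space M. X \<omega> = k} = exp (\<gamma> - T + r) * pmf (poisson_pmf r) k" for k
  proof -
    have "r ^ k = T ^ k * exp (\<beta> * real k)"
      by (simp add: r_def power_mult_distrib exp_of_nat_mult mult.commute[of \<beta>])
    then show ?thesis
      using f T \<open>r > 0\<close> by (simp add: has_poisson_density_def exp exp_add exp_diff exp_minus field_simps)
  qed
  \<comment> \<open>Both the law of \<open>X\<close> and the Poisson weights have total mass 1,
    which forces the remaining constant factor to be 1.\<close>
  have "(\<lambda>k. prob {\<omega> \<in> space M. X \<omega> = k}) sums prob (\<Union>k. {\<omega> \<in> space M. X \<omega> = k})"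
    by (intro finite_measure_UNION image_subsetI; (measurable)?) (auto simp: disjoint_family_on_def)
  moreover have "(\<Union>k. {\<omega> \<in> space M. X \<omega> = k}) = space M"
    by auto
  ultimately have "(\<lambda>k. exp (\<gamma> - T + r) * pmf (poisson_pmf r) k) sums 1"
    by (simp only: law prob_space)
  moreover have "(\<lambda>k. pmf (poisson_pmf r) k) sums 1"
  proof -
    have "(\<lambda>k. exp (- r) * (inverse (fact k) *\<^sub>R r ^ k)) sums (exp (- r) * exp r)"
      by (intro sums_mult exp_converges)
    then show ?thesis
      using \<open>r > 0\<close> by (simp add: exp_minus field_simps)
  qed
  then have "(\<lambda>k. exp (\<gamma> - T + r) * pmf (poisson_pmf r) k) sums (exp (\<gamma> - T + r) * 1)"
    by (rule sums_mult)
  ultimately have "exp (\<gamma> - T + r) = 1"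
    using sums_unique2 by fastforce
  with law have law: "prob {\<omega> \<in> space M. X \<omega> = k} = pmf (poisson_pmf r) k" for k
    by simp
  have "distr M (count_space UNIV) X = measure_pmf (poisson_pmf r)"
  proof (rule measure_eqI_countable[of _ UNIV])
    fix k :: nat
    have "emeasure (distr M (count_space UNIV) X) {k} = emeasure M {\<omega> \<in> space M. X \<omega> = k}"
      by (simp add: emeasure_distr vimage_def Int_def conj_commute)
    then show "emeasure (distr M (count_space UNIV) X) {k} = emeasure (measure_pmf (poisson_pmf r)) {k}"
      by (simp add: emeasure_eq_measure law emeasure_pmf_single del: pmf_poisson)
  qed auto
  with \<open>r > 0\<close> show "\<exists>r>0. distr M (count_space UNIV) X = measure_pmf (poisson_pmf r)"
    by blast
next
  assume "\<exists>r>0. distr M (count_space UNIV) X = measure_pmf (poisson_pmf r)"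
  then obtain r where "r > 0" and r: "distr M (count_space UNIV) X = measure_pmf (poisson_pmf r)"
    by blast
  \<comment> \<open>The density is the quotient of the two Poisson weights,
    \<open>(r / T) ^ k * exp (T - r)\<close>.\<close>
  have "f k = exp (ln (r / T) * real k + (T - r))" for k
  proof -
    have "prob {\<omega> \<in> space M. X \<omega> = k} = measure (distr M (count_space UNIV) X) {k}"
      by (simp add: measure_distr vimage_def Int_def conj_commute)
    also have "\<dots> = pmf (poisson_pmf r) k"
      by (simp add: r pmf.rep_eq)
    finally have "f k * (T ^ k * exp (- T)) = r ^ k * exp (- r)"
      using f T \<open>r > 0\<close> by (simp add: has_poisson_density_def field_simps)
    moreover have "exp (ln (r / T) * real k) = (r / T) ^ k"
      using T \<open>r > 0\<close> by (simp add: exp_of_nat_mult mult.commute[of _ "real k"])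
    ultimately show ?thesis
      using T by (simp only: exp_add exp_diff exp_minus power_divide) (simp add: field_simps)
  qed
  then show "\<exists>\<beta> \<gamma>. \<forall>k. f k = exp (\<beta> * real k + \<gamma>)"
    by blast
qed

section \<open>Characterisation of equality\<close>

theorem proposition3p24:
  fixes M :: "'a measure" and X :: "'a \<Rightarrow> nat" and f :: "nat \<Rightarrow> real" and T :: real
    and thin :: "real \<Rightarrow> 'a \<Rightarrow> nat"
  assumes "prob_space M"
    and "T > 0"
    and "X \<in> measurable M (count_space UNIV)"
    and "\<And>k. f k > 0"
    and "has_poisson_density M X f T"
    and "summable (\<lambda>k. (forward_diff f k)\<^sup>2 / f k * pmf (poisson_pmf T) k)"
    and "\<And>a. 0 < a \<Longrightarrow> a < 1 \<Longrightarrow> is_thinning M a X (thin a)"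
  shows "((\<forall>a. 0 < a \<and> a < 1 \<longrightarrow>
            fisher_information M (thin a) (a * T) = ennreal a * fisher_information M X T)
          \<longleftrightarrow> (\<exists>\<beta> \<gamma>. \<forall>k. f k = exp (\<beta> * real k + \<gamma>)))
       \<and> ((\<exists>\<beta> \<gamma>. \<forall>k. f k = exp (\<beta> * real k + \<gamma>))
          \<longleftrightarrow> (\<exists>r>0. distr M (count_space UNIV) X = measure_pmf (poisson_pmf r)))"
proof -
  interpret prob_space M by fact
  note pos = \<open>\<And>k. f k > 0\<close> and dens = \<open>has_poisson_density M X f T\<close>
  let ?eq = "\<forall>a. 0 < a \<and> a < 1 \<longrightarrow> fisher_information M (thin a) (a * T) = ennreal a * fisher_information M X T"
  let ?g = "\<lambda>a. poisson_density M (thin a) (a * T)"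
  note g_pos = poisson_density_thinning_pos[OF _ _ \<open>T > 0\<close> pos dens assms(7)]
    and Dg = forward_diff_poisson_density_thinning[OF _ _ \<open>T > 0\<close> pos dens assms(7)]
    and defect = fisher_information_thinning_defect[OF _ _ \<open>T > 0\<close> pos dens assms(7) assms(6)]
  have "?eq \<longleftrightarrow> (\<exists>c. \<forall>k. forward_diff f k = c * f k)"
  proof
    assume ?eq
    \<comment> \<open>Any value strictly between 0 and 1 would serve.\<close>
    define a :: real where "a = 1 / 2"
    have a: "0 < a" "a < 1"
      by (simp_all add: a_def)
    \<comment> \<open>Row \<open>j = 0\<close> of the gap runs over all values \<open>f m\<close>,
      so its vanishing alone gives proportionality with this constant.\<close>
    let ?c = "forward_diff (?g a) 0 / ?g a 0"
    let ?D = "\<lambda>j. (\<Sum>m. ennreal ((forward_diff f (j + m) - forward_diff (?g a) j / ?g a j * f (j + m))\<^sup>2 / f (j + m)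
             * pmf (poisson_pmf ((1 - a) * T)) m)) * ennreal (pmf (poisson_pmf (a * T)) j)"
    \<comment> \<open>Cancellation in \<open>ennreal\<close> fails at infinity, hence the finiteness
      of the information is established before it is used.\<close>
    have cancel: "z = 0" if "y = x + z" "x = y" "y \<noteq> \<top>" for x y z :: ennreal
      using that ennreal_add_left_cancel[of y z 0] by simp
    have "fisher_information M X T \<noteq> \<top>"
    proof -
      have "(\<Sum>k. ennreal ((forward_diff f k)\<^sup>2 / f k * pmf (poisson_pmf T) k)) \<noteq> \<top>"
        using pos by (intro ennreal_suminf_neq_top assms(6)) (simp add: less_imp_le del: pmf_poisson)
      moreover have "ennreal ((forward_diff f k)\<^sup>2 / f k * pmf (poisson_pmf T) k)
          = ennreal ((forward_diff f k)\<^sup>2 / f k) * ennreal (pmf (poisson_pmf T) k)" for k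
        using pos[of k] by (intro ennreal_mult') simp
      ultimately show ?thesis
        using fisher_information_positive_density[of M X T] pos
          dens[unfolded has_poisson_density_iff[OF \<open>T > 0\<close>], symmetric]
        by (simp add: ennreal_mult_eq_top_iff del: pmf_poisson times_divide_eq_left)
    qed
    then have "ennreal a * fisher_information M X T \<noteq> \<top>"
      by (simp add: ennreal_mult_eq_top_iff)
    then have "ennreal (a * T) * suminf ?D = 0"
      by (rule cancel[OF defect[OF a a] \<open>?eq\<close>[rule_format, OF conjI, OF a]])
    then have "suminf ?D = 0"
      using a \<open>T > 0\<close> by simp
    then have "?D 0 = 0"
      by (simp only: suminf_eq_zero_iff[OF summableI] zero_le)
    then have "(\<Sum>m. ennreal ((forward_diff f m - ?c * f m)\<^sup>2 / f m * pmf (poisson_pmf ((1 - a) * T)) m)) = 0"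
      using a \<open>T > 0\<close> by simp
    then have "ennreal ((forward_diff f m - ?c * f m)\<^sup>2 / f m * pmf (poisson_pmf ((1 - a) * T)) m) = 0" for m
      by (simp only: suminf_eq_zero_iff[OF summableI] zero_le)
    \<comment> \<open>A zero of \<open>ennreal\<close> only bounds the real argument from above; a
      nonzero square would contradict this by strict positivity.\<close>
    then have terms: "(forward_diff f m - ?c * f m)\<^sup>2 / f m * pmf (poisson_pmf ((1 - a) * T)) m \<le> 0" for m
      by (simp only: ennreal_eq_0_iff)
    have "forward_diff f m = ?c * f m" for m
    proof (rule ccontr)
      assume "forward_diff f m \<noteq> ?c * f m"
      then have "(forward_diff f m - ?c * f m)\<^sup>2 > 0"
        by simp
      moreover have "pmf (poisson_pmf ((1 - a) * T)) m > 0"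
        using a \<open>T > 0\<close> by simp
      ultimately have "(forward_diff f m - ?c * f m)\<^sup>2 / f m * pmf (poisson_pmf ((1 - a) * T)) m > 0"
        by (intro mult_pos_pos divide_pos_pos pos)
      then show False
        using terms[of m] by (rule leD[THEN notE, rotated])
    qed
    then show "\<exists>c. \<forall>k. forward_diff f k = c * f k"
      by blast
  next
    assume "\<exists>c. \<forall>k. forward_diff f k = c * f k"
    then obtain c where c: "\<And>k. forward_diff f k = c * f k"
      by blast
    have "fisher_information M (thin a) (a * T) = ennreal a * fisher_information M X T" if a: "0 < a" "a < 1" for a
    proof -
      \<comment> \<open>Proportionality passes through the average with the same \<open>c\<close>,
        so every square in the gap vanishes.\<close>
      have "forward_diff (?g a) j = c * ?g a j" for j
      proof (rule sums_unique2)
        show "(\<lambda>m. c * (f (j + m) * pmf (poisson_pmf ((1 - a) * T)) m)) sums (c * ?g a j)"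
          by (intro sums_mult poisson_density_thinning[OF a \<open>T > 0\<close> dens assms(7)] a)
        show "(\<lambda>m. c * (f (j + m) * pmf (poisson_pmf ((1 - a) * T)) m)) sums forward_diff (?g a) j"
          using Dg[OF a a, of j] by (simp only: c mult.assoc)
      qed
      then have "forward_diff (?g a) j / ?g a j = c" for j
        using g_pos[OF a a, of j] by simp
      then show ?thesis
        using defect[OF a a] by (simp add: c)
    qed
    then show ?eq
      by blast
  qed
  then show ?thesis
    using forward_diff_proportional_iff_exp[of f] pos
      exp_poisson_density_iff_poisson[OF \<open>T > 0\<close> assms(3) dens]
    by simp
qed

end
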